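(* Let $A$ and $B$ be any monoids. The Schützenberger product $A\Diamond B$ is regular if and only if both of the following conditions hold: (i) $A$ and $B$ are regular; (ii) for every $(a,P,b)\in A\Diamond B$, either $$P=aP_1b=\bigcup_{(a_1,b_1)\in P_1}\{(aa_1,\,b_1b)\}$$ for some $P_1\subseteq A\times B$, or $$P=caP_1bd=\bigcup_{(a_1,b_1)\in P_1}\{(caa_1,\,b_1bd)\}$$ for some $P_1\subseteq A\times B$, $c\in a^{-1}$ and $d\in b^{-1}$.
   Context: For a monoid $M$ and $a\in M$, write $a^{-1}=\{b\in M : aba=a \text{ and } bab=b\}$ for the set of (semigroup) inverses of $a$ in $M$. The monoid $M$ is called regular if for every $a\in M$ there exists $b\in M$ with $aba=a$ and $bab=b$, i.e. $a^{-1}\neq\emptyset$ for every $a\in M$. For monoids $A,B$, a subset $P\subseteq A\times B$, and $a\in A$, $b\in B$, put $Pb=\{(c,db) : (c,d)\in P\}$ and $aP=\{(ac,d) : (c,d)\in P\}$. The Schützenberger product $A\Diamond B$ is the set $A\times \mathcal{P}(A\times B)\times B$, where $\mathcal{P}(A\times B)$ is the power set of $A\times B$, with multiplication $$(a_1,P_1,b_1)(a_2,P_2,b_2)=(a_1a_2,\;P_1b_2\cup a_1P_2,\;b_1b_2).$$ It is a monoid with identity $(1_A,\emptyset,1_B)$. *)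

theory Defs
  imports "HOL-Algebra.Group"
begin

definition sg_inverses :: "('a, 'm) monoid_scheme \<Rightarrow> 'a \<Rightarrow> 'a set"
  where "sg_inverses M a =
    {b \<in> carrier M. a \<otimes>\<^bsub>M\<^esub> b \<otimes>\<^bsub>M\<^esub> a = a \<and> b \<otimes>\<^bsub>M\<^esub> a \<otimes>\<^bsub>M\<^esub> b = b}"

locale regular_monoid = monoid +
  assumes regular: "a \<in> carrier G \<Longrightarrow> sg_inverses G a \<noteq> {}"

text \<open>The sets \<open>aP\<close> and \<open>Pb\<close>: \<open>A\<close> acts on the first coordinate only, from the left,
  and \<open>B\<close> on the second coordinate only, from the right.\<close>

definition lact :: "('a, 'm) monoid_scheme \<Rightarrow> 'a \<Rightarrow> ('a \<times> 'b) set \<Rightarrow> ('a \<times> 'b) set"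
  where "lact A a P = {(a \<otimes>\<^bsub>A\<^esub> c, d) | c d. (c, d) \<in> P}"

definition ract :: "('b, 'n) monoid_scheme \<Rightarrow> ('a \<times> 'b) set \<Rightarrow> 'b \<Rightarrow> ('a \<times> 'b) set"
  where "ract B P b = {(c, d \<otimes>\<^bsub>B\<^esub> b) | c d. (c, d) \<in> P}"

definition schuetzenberger ::
    "('a, 'm) monoid_scheme \<Rightarrow> ('b, 'n) monoid_scheme \<Rightarrow> ('a \<times> ('a \<times> 'b) set \<times> 'b) monoid"
    (infixr \<open>\<diamond>\<close> 70)
  where "A \<diamond> B =
    \<lparr>carrier = carrier A \<times> Pow (carrier A \<times> carrier B) \<times> carrier B,
     mult = (\<lambda>(a\<^sub>1, P\<^sub>1, b\<^sub>1) (a\<^sub>2, P\<^sub>2, b\<^sub>2).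
       (a\<^sub>1 \<otimes>\<^bsub>A\<^esub> a\<^sub>2, ract B P\<^sub>1 b\<^sub>2 \<union> lact A a\<^sub>1 P\<^sub>2, b\<^sub>1 \<otimes>\<^bsub>B\<^esub> b\<^sub>2)),
     one = (\<one>\<^bsub>A\<^esub>, {}, \<one>\<^bsub>B\<^esub>)\<rparr>"

lemma ract_lact_eq_UN:
  "ract B (lact A a P) b = (\<Union>(a\<^sub>1, b\<^sub>1)\<in>P. {(a \<otimes>\<^bsub>A\<^esub> a\<^sub>1, b\<^sub>1 \<otimes>\<^bsub>B\<^esub> b)})"
  by (auto simp: lact_def ract_def)

lemma lact_ract_commute: "ract B (lact A a P) b = lact A a (ract B P b)"
  unfolding lact_def ract_def by blast

lemma lact_closed:
  assumes "monoid A" "a \<in> carrier A" "P \<subseteq> carrier A \<times> carrier B"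
  shows "lact A a P \<subseteq> carrier A \<times> carrier B"
  using assms by (auto simp: lact_def intro: monoid.m_closed)

lemma ract_closed:
  assumes "monoid B" "b \<in> carrier B" "P \<subseteq> carrier A \<times> carrier B"
  shows "ract B P b \<subseteq> carrier A \<times> carrier B"
  using assms by (auto simp: ract_def intro: monoid.m_closed)

lemma lact_lact:
  assumes "monoid A" "a \<in> carrier A" "a' \<in> carrier A" "P \<subseteq> carrier A \<times> carrier B"
  shows "lact A a (lact A a' P) = lact A (a \<otimes>\<^bsub>A\<^esub> a') P"
proof -
  have "lact A a (lact A a' P) = (\<lambda>(c, d). (a \<otimes>\<^bsub>A\<^esub> (a' \<otimes>\<^bsub>A\<^esub> c), d)) ` P"
    by (force simp: lact_def)
  also have "\<dots> = (\<lambda>(c, d). (a \<otimes>\<^bsub>A\<^esub> a' \<otimes>\<^bsub>A\<^esub> c, d)) ` P"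
    using assms by (intro image_cong) (auto simp: monoid.m_assoc)
  also have "\<dots> = lact A (a \<otimes>\<^bsub>A\<^esub> a') P"
    by (force simp: lact_def)
  finally show ?thesis .
qed

lemma ract_ract:
  assumes "monoid B" "b \<in> carrier B" "b' \<in> carrier B" "P \<subseteq> carrier A \<times> carrier B"
  shows "ract B (ract B P b) b' = ract B P (b \<otimes>\<^bsub>B\<^esub> b')"
proof -
  have "ract B (ract B P b) b' = (\<lambda>(c, d). (c, d \<otimes>\<^bsub>B\<^esub> b \<otimes>\<^bsub>B\<^esub> b')) ` P"
    by (force simp: ract_def)
  also have "\<dots> = (\<lambda>(c, d). (c, d \<otimes>\<^bsub>B\<^esub> (b \<otimes>\<^bsub>B\<^esub> b'))) ` P"
    using assms by (intro image_cong) (auto simp: monoid.m_assoc)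
  also have "\<dots> = ract B P (b \<otimes>\<^bsub>B\<^esub> b')"
    by (force simp: ract_def)
  finally show ?thesis .
qed

lemma lact_one:
  assumes "monoid A" "P \<subseteq> carrier A \<times> carrier B"
  shows "lact A \<one>\<^bsub>A\<^esub> P = P"
proof -
  have "lact A \<one>\<^bsub>A\<^esub> P = (\<lambda>(c, d). (\<one>\<^bsub>A\<^esub> \<otimes>\<^bsub>A\<^esub> c, d)) ` P"
    by (force simp: lact_def)
  also have "\<dots> = id ` P"
    using assms by (intro image_cong) (auto simp: monoid.l_one)
  finally show ?thesis by simp
qed

lemma ract_one:
  assumes "monoid B" "P \<subseteq> carrier A \<times> carrier B"
  shows "ract B P \<one>\<^bsub>B\<^esub> = P"
proof -
  have "ract B P \<one>\<^bsub>B\<^esub> = (\<lambda>(c, d). (c, d \<otimes>\<^bsub>B\<^esub> \<one>\<^bsub>B\<^esub>)) ` P"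
    by (force simp: ract_def)
  also have "\<dots> = id ` P"
    using assms by (intro image_cong) (auto simp: monoid.r_one)
  finally show ?thesis by simp
qed

lemma lact_Un: "lact A a (P \<union> Q) = lact A a P \<union> lact A a Q"
  by (auto simp: lact_def)

lemma ract_Un: "ract B (P \<union> Q) b = ract B P b \<union> ract B Q b"
  by (auto simp: ract_def)

lemma lact_empty [simp]: "lact A a {} = {}"
  by (simp add: lact_def)

lemma ract_empty [simp]: "ract B {} b = {}"
  by (simp add: ract_def)

lemma monoid_schuetzenberger:
  assumes A: "monoid A" and B: "monoid B"
  shows "monoid (A \<diamond> B)"
proof (rule monoidI)
  fix x y assume "x \<in> carrier (A \<diamond> B)" "y \<in> carrier (A \<diamond> B)"
  then show "x \<otimes>\<^bsub>A \<diamond> B\<^esub> y \<in> carrier (A \<diamond> B)"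
    by (cases x; cases y)
      (simp add: schuetzenberger_def monoid.m_closed[OF A] monoid.m_closed[OF B]
        lact_closed[OF A] ract_closed[OF B])
next
  show "\<one>\<^bsub>A \<diamond> B\<^esub> \<in> carrier (A \<diamond> B)"
    by (simp add: schuetzenberger_def monoid.one_closed[OF A] monoid.one_closed[OF B])
next
  fix x y z
  assume "x \<in> carrier (A \<diamond> B)" "y \<in> carrier (A \<diamond> B)" "z \<in> carrier (A \<diamond> B)"
  then show "x \<otimes>\<^bsub>A \<diamond> B\<^esub> y \<otimes>\<^bsub>A \<diamond> B\<^esub> z = x \<otimes>\<^bsub>A \<diamond> B\<^esub> (y \<otimes>\<^bsub>A \<diamond> B\<^esub> z)"
    by (cases x; cases y; cases z)
      (simp add: schuetzenberger_def monoid.m_assoc[OF A] monoid.m_assoc[OF B]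
        lact_Un ract_Un lact_lact[OF A, of _ _ _ B] ract_ract[OF B, of _ _ _ A]
        lact_ract_commute Un_assoc)
next
  fix x assume "x \<in> carrier (A \<diamond> B)"
  then show "\<one>\<^bsub>A \<diamond> B\<^esub> \<otimes>\<^bsub>A \<diamond> B\<^esub> x = x" "x \<otimes>\<^bsub>A \<diamond> B\<^esub> \<one>\<^bsub>A \<diamond> B\<^esub> = x"
    by (cases x; simp add: schuetzenberger_def monoid.l_one[OF A] monoid.l_one[OF B]
        monoid.r_one[OF A] monoid.r_one[OF B] lact_one[OF A, of _ B] ract_one[OF B, of _ A])+
qed

end

theory Submission
  imports Defs
begin

text \<open>Testing either side of the equivalence on the singleton \<open>P = {(1, 1)}\<close> shows that every
  element of \<open>A\<close> and of \<open>B\<close> has a one-sided inverse. In such a monoid the only idempotent is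
  \<open>1\<close>, so one-sided inverses are two-sided. Hence both sides of the equivalence say that
  \<open>A\<close> and \<open>B\<close> are groups.\<close>

lemma mem_lact_iff: "(x, y) \<in> lact A a P \<longleftrightarrow> (\<exists>c. x = a \<otimes>\<^bsub>A\<^esub> c \<and> (c, y) \<in> P)"
  by (auto simp: lact_def)

lemma mem_ract_iff: "(x, y) \<in> ract B P b \<longleftrightarrow> (\<exists>d. y = d \<otimes>\<^bsub>B\<^esub> b \<and> (x, d) \<in> P)"
  by (auto simp: ract_def)

lemma carrier_schuetzenberger [simp]:
  "(a, P, b) \<in> carrier (A \<diamond> B) \<longleftrightarrow>
    a \<in> carrier A \<and> P \<subseteq> carrier A \<times> carrier B \<and> b \<in> carrier B"
  by (simp add: schuetzenberger_def)

lemma mult_schuetzenberger [simp]: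
  "(a, P, b) \<otimes>\<^bsub>A \<diamond> B\<^esub> (a', P', b') =
    (a \<otimes>\<^bsub>A\<^esub> a', ract B P b' \<union> lact A a P', b \<otimes>\<^bsub>B\<^esub> b')"
  by (simp add: schuetzenberger_def)

text \<open>Multiplying \<open>x x = x\<close> by \<open>y\<close> on the side where
  \<open>y\<close> cancels \<open>x\<close> leaves \<open>x = 1\<close>.\<close>

lemma (in monoid) idem_one_sided_unit_eq_one:
  assumes x: "x \<in> carrier G" "x \<otimes> x = x"
    and y: "y \<in> carrier G" "x \<otimes> y = \<one> \<or> y \<otimes> x = \<one>"
  shows "x = \<one>"
  using y(2)
proof
  assume "x \<otimes> y = \<one>"
  then show ?thesis using x y(1) m_assoc[of x x y] by simp
next
  assume "y \<otimes> x = \<one>"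
  then show ?thesis using x y(1) m_assoc[of y x x] by simp
qed

text \<open>The side may vary with the element. If \<open>a c = 1\<close>, then \<open>c a\<close>
  is idempotent and itself has a one-sided inverse, so it is \<open>1\<close>; thus every one-sided
  inverse is two-sided.\<close>

lemma (in monoid) group_if_one_sided_inverses:
  assumes ex: "\<And>a. a \<in> carrier G \<Longrightarrow> \<exists>c \<in> carrier G. a \<otimes> c = \<one> \<or> c \<otimes> a = \<one>"
  shows "group G"
proof -
  have flip: "c \<otimes> a = \<one>" if ac: "a \<in> carrier G" "c \<in> carrier G" "a \<otimes> c = \<one>" for a c
  proof -
    have "(c \<otimes> a) \<otimes> (c \<otimes> a) = c \<otimes> (a \<otimes> c) \<otimes> a"
      using ac(1,2) by (simp only: m_assoc m_closed)
    then have "(c \<otimes> a) \<otimes> (c \<otimes> a) = c \<otimes> a"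
      using ac by simp
    then show ?thesis
      using ac ex[of "c \<otimes> a"] idem_one_sided_unit_eq_one[of "c \<otimes> a"] by auto
  qed
  show ?thesis
  proof (unfold_locales, rule subsetI)
    fix a assume a: "a \<in> carrier G"
    \<comment> \<open>If the inverse \<open>c\<close> of \<open>a\<close> is a left one,
      \<open>flip\<close> applies with the roles of \<open>a\<close> and \<open>c\<close>
      exchanged.\<close>
    from ex[OF this] show "a \<in> Units G"
      using a flip unfolding Units_def by blast
  qed
qed

lemma (in group) inv_in_sg_inverses:
  assumes "a \<in> carrier G"
  shows "inv a \<in> sg_inverses G a"
  using assms by (simp add: sg_inverses_def)

lemma (in group) regular_monoid: "regular_monoid G"
  by unfold_locales (use inv_in_sg_inverses in blast)

text \<open>The left and right actions commute, so the translations by \<open>a\<close> and its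
  inverse, and by \<open>b\<close> and its inverse, meet and cancel. This writes every
  \<open>P\<close> as \<open>a P1 b\<close>, the first alternative of condition (ii).\<close>

lemma lact_ract_inv_cancel:
  assumes "group A" "group B" and "a \<in> carrier A" "b \<in> carrier B"
    and "P \<subseteq> carrier A \<times> carrier B"
  shows "ract B (lact A a (ract B (lact A (inv\<^bsub>A\<^esub> a) P) (inv\<^bsub>B\<^esub> b))) b = P"
proof -
  interpret A: group A by fact
  interpret B: group B by fact
  show ?thesis
    using assms(3-5)
    by (simp add: lact_ract_commute lact_lact[of _ _ _ _ B] ract_ract[of _ _ _ _ A]
        ract_closed lact_closed lact_one[of _ _ B] ract_one[of _ _ A] A.is_monoid B.is_monoid)
qed

text \<open>Writing \<open>a'\<close> and \<open>b'\<close> for the group inverses, an inverse of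
  \<open>(a, P, b)\<close> is \<open>(a', a' P b', b')\<close>.\<close>

lemma regular_schuetzenberger_if_group:
  assumes gA: "group A" and gB: "group B"
  shows "regular_monoid (A \<diamond> B)"
proof -
  interpret A: group A by fact
  interpret B: group B by fact
  interpret S: monoid "A \<diamond> B"
    by (rule monoid_schuetzenberger) unfold_locales
  show ?thesis
  proof
    fix x assume x: "x \<in> carrier (A \<diamond> B)"
    obtain a P b where abP: "x = (a, P, b)" by (cases x)
    define Q where "Q = ract B (lact A (inv\<^bsub>A\<^esub> a) P) (inv\<^bsub>B\<^esub> b)"
    from x abP have c: "a \<in> carrier A" "b \<in> carrier B" "P \<subseteq> carrier A \<times> carrier B"
      by auto
    have Q: "Q \<subseteq> carrier A \<times> carrier B"
      unfolding Q_def using c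
      by (intro ract_closed lact_closed) (auto simp: A.is_monoid B.is_monoid)
    have P_Q: "ract B (lact A a Q) b = P"
      unfolding Q_def using lact_ract_inv_cancel[OF gA gB c] .
    \<comment> \<open>The middle component of \<open>x y x\<close> is the union of
      \<open>P b' b\<close>, \<open>a Q b\<close> and \<open>a a' P\<close>, each equal to
      \<open>P\<close>. That of \<open>y x y\<close> is the union of \<open>Q b b'\<close>,
      \<open>a' P b'\<close> and \<open>a' a Q\<close>, each equal to \<open>Q\<close>.\<close>
    have "(inv\<^bsub>A\<^esub> a, Q, inv\<^bsub>B\<^esub> b) \<in> sg_inverses (A \<diamond> B) x"
      using c Q P_Q Q_def[symmetric]
      by (simp add: sg_inverses_def abP ract_Un lact_ract_commute ract_ract[of _ _ _ _ A]
          lact_one[of _ _ B] ract_one[of _ _ A] A.is_monoid B.is_monoid)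
    then show "sg_inverses (A \<diamond> B) x \<noteq> {}" by blast
  qed
qed

text \<open>Regularity is applied to \<open>(a, {(1, 1)}, b)\<close>: a singleton middle component
  leaves no room for the terms that a product with an inverse adds to it.\<close>

lemma one_sided_inverses_if_regular_schuetzenberger:
  assumes mA: "monoid A" and mB: "monoid B" and reg: "regular_monoid (A \<diamond> B)"
    and ab: "a \<in> carrier A" "b \<in> carrier B"
  shows "\<exists>c \<in> carrier A. \<exists>d \<in> carrier B. a \<otimes>\<^bsub>A\<^esub> c = \<one>\<^bsub>A\<^esub> \<and> d \<otimes>\<^bsub>B\<^esub> b = \<one>\<^bsub>B\<^esub>"
proof -
  interpret A: monoid A by fact
  interpret B: monoid B by fact
  let ?P = "{(\<one>\<^bsub>A\<^esub>, \<one>\<^bsub>B\<^esub>)}"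
  have "(a, ?P, b) \<in> carrier (A \<diamond> B)" using ab by simp
  then obtain y where y: "y \<in> sg_inverses (A \<diamond> B) (a, ?P, b)"
    using regular_monoid.regular[OF reg] by blast
  obtain c Q d where cQd: "y = (c, Q, d)" by (cases y)
  \<comment> \<open>\<open>eq\<close> is the middle component of \<open>x y x = x\<close>. Its left
    side contains \<open>P d b = {(1, d b)}\<close> and \<open>a c P = {(a c, 1)}\<close>, and its
    right side is only \<open>{(1, 1)}\<close>.\<close>
  from y have cd: "c \<in> carrier A" "d \<in> carrier B"
    and eq: "ract B (ract B ?P d \<union> lact A a Q) b \<union> lact A (a \<otimes>\<^bsub>A\<^esub> c) ?P = ?P"
    by (auto simp: cQd sg_inverses_def)
  have "(\<one>\<^bsub>A\<^esub>, d \<otimes>\<^bsub>B\<^esub> b) \<in> ?P" "(a \<otimes>\<^bsub>A\<^esub> c, \<one>\<^bsub>B\<^esub>) \<in> ?P"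
    using ab cd by (subst eq[symmetric], simp add: ract_Un mem_lact_iff mem_ract_iff)+
  then show ?thesis using cd by auto
qed

theorem theorem2p1:
  fixes A :: "('a, 'm) monoid_scheme" and B :: "('b, 'n) monoid_scheme"
  assumes "monoid A" and "monoid B"
  shows "regular_monoid (A \<diamond> B) \<longleftrightarrow>
    (regular_monoid A \<and> regular_monoid B) \<and>
    (\<forall>(a, P, b) \<in> carrier (A \<diamond> B).
      (\<exists>P\<^sub>1. P\<^sub>1 \<subseteq> carrier A \<times> carrier B \<and> P = ract B (lact A a P\<^sub>1) b) \<or>
      (\<exists>P\<^sub>1 c d. P\<^sub>1 \<subseteq> carrier A \<times> carrier B \<and> c \<in> sg_inverses A a \<and> d \<in> sg_inverses B b \<and>
        P = ract B (lact A (c \<otimes>\<^bsub>A\<^esub> a) P\<^sub>1) (b \<otimes>\<^bsub>B\<^esub> d)))"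
    (is "?L \<longleftrightarrow> ?R \<and> ?ii")
proof -
  interpret A: monoid A by fact
  interpret B: monoid B by fact
  \<comment> \<open>To treat one monoid alone, the element of the other is taken to be
    \<open>1\<close>.\<close>
  have groups: "group A \<and> group B" if L: ?L
    using one_sided_inverses_if_regular_schuetzenberger[OF assms L] A.one_closed B.one_closed
    by (intro conjI A.group_if_one_sided_inverses B.group_if_one_sided_inverses) blast+
  show ?thesis
  proof
    assume ?L
    then have g: "group A" "group B" using groups by auto
    have ?ii
    proof clarify
      fix a P b
      assume "(a, P, b) \<in> carrier (A \<diamond> B)"
      then have c: "a \<in> carrier A" "b \<in> carrier B" "P \<subseteq> carrier A \<times> carrier B" by auto
      let ?Q = "ract B (lact A (inv\<^bsub>A\<^esub> a) P) (inv\<^bsub>B\<^esub> b)"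
      have "?Q \<subseteq> carrier A \<times> carrier B"
        using c g assms by (intro ract_closed lact_closed) auto
      then show "\<exists>P\<^sub>1. P\<^sub>1 \<subseteq> carrier A \<times> carrier B \<and> P = ract B (lact A a P\<^sub>1) b"
        using lact_ract_inv_cancel[OF g c] by (intro exI[of _ ?Q]) auto
    qed
    then show "?R \<and> ?ii"
      using g by (simp add: group.regular_monoid)
  next
    assume "?R \<and> ?ii"
    then have ii: ?ii by blast
    let ?P = "{(\<one>\<^bsub>A\<^esub>, \<one>\<^bsub>B\<^esub>)}"
    \<comment> \<open>The side depends on which alternative of (ii) holds for
      \<open>{(1, 1)}\<close>: the first gives \<open>a\<close> a right and \<open>b\<close> a left
      inverse, the second gives \<open>a\<close> a left and \<open>b\<close> a right one.\<close>
    have one_sided: "(\<exists>c \<in> carrier A. a \<otimes>\<^bsub>A\<^esub> c = \<one>\<^bsub>A\<^esub> \<or> c \<otimes>\<^bsub>A\<^esub> a = \<one>\<^bsub>A\<^esub>) \<and>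
        (\<exists>d \<in> carrier B. b \<otimes>\<^bsub>B\<^esub> d = \<one>\<^bsub>B\<^esub> \<or> d \<otimes>\<^bsub>B\<^esub> b = \<one>\<^bsub>B\<^esub>)"
      if ab: "a \<in> carrier A" "b \<in> carrier B" for a b
    proof -
      have "(a, ?P, b) \<in> carrier (A \<diamond> B)" using ab by simp
      from bspec[OF ii this, simplified] show ?thesis
      proof (elim disjE exE conjE)
        fix P1 assume P1: "P1 \<subseteq> carrier A \<times> carrier B" and "?P = ract B (lact A a P1) b"
        then have "(\<one>\<^bsub>A\<^esub>, \<one>\<^bsub>B\<^esub>) \<in> ract B (lact A a P1) b" by blast
        then obtain x y where "(x, y) \<in> P1" "\<one>\<^bsub>A\<^esub> = a \<otimes>\<^bsub>A\<^esub> x" "\<one>\<^bsub>B\<^esub> = y \<otimes>\<^bsub>B\<^esub> b"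
          by (auto simp: mem_lact_iff mem_ract_iff)
        with P1 show ?thesis by force
      next
        fix P1 c d
        assume P1: "P1 \<subseteq> carrier A \<times> carrier B"
          and cd: "c \<in> sg_inverses A a" "d \<in> sg_inverses B b"
          and "?P = ract B (lact A (c \<otimes>\<^bsub>A\<^esub> a) P1) (b \<otimes>\<^bsub>B\<^esub> d)"
        then have "(\<one>\<^bsub>A\<^esub>, \<one>\<^bsub>B\<^esub>) \<in> ract B (lact A (c \<otimes>\<^bsub>A\<^esub> a) P1) (b \<otimes>\<^bsub>B\<^esub> d)" by blast
        then obtain x y where xy: "(x, y) \<in> P1" "c \<otimes>\<^bsub>A\<^esub> a \<otimes>\<^bsub>A\<^esub> x = \<one>\<^bsub>A\<^esub>"
            "y \<otimes>\<^bsub>B\<^esub> (b \<otimes>\<^bsub>B\<^esub> d) = \<one>\<^bsub>B\<^esub>"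
          by (auto simp: mem_lact_iff mem_ract_iff)
        have carr: "x \<in> carrier A" "y \<in> carrier B" "c \<in> carrier A" "d \<in> carrier B"
          using P1 xy cd by (auto simp: sg_inverses_def)
        \<comment> \<open>By \<open>c a c = c\<close> and \<open>b d b = b\<close>, both
          \<open>c a\<close> and \<open>b d\<close> are idempotent. Since \<open>x\<close> is a
          right inverse of \<open>c a\<close> and \<open>y\<close> a left inverse of
          \<open>b d\<close>, both are \<open>1\<close>.\<close>
        have "(c \<otimes>\<^bsub>A\<^esub> a) \<otimes>\<^bsub>A\<^esub> (c \<otimes>\<^bsub>A\<^esub> a) = c \<otimes>\<^bsub>A\<^esub> a"
          using cd carr ab A.m_assoc[of "c \<otimes>\<^bsub>A\<^esub> a" c a] by (simp add: sg_inverses_def)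
        then have "c \<otimes>\<^bsub>A\<^esub> a = \<one>\<^bsub>A\<^esub>"
          using A.idem_one_sided_unit_eq_one[of "c \<otimes>\<^bsub>A\<^esub> a" x] xy carr ab by simp
        moreover have "(b \<otimes>\<^bsub>B\<^esub> d) \<otimes>\<^bsub>B\<^esub> (b \<otimes>\<^bsub>B\<^esub> d) = b \<otimes>\<^bsub>B\<^esub> d"
          using cd carr ab B.m_assoc[of "b \<otimes>\<^bsub>B\<^esub> d" b d] by (simp add: sg_inverses_def)
        then have "b \<otimes>\<^bsub>B\<^esub> d = \<one>\<^bsub>B\<^esub>"
          using B.idem_one_sided_unit_eq_one[of "b \<otimes>\<^bsub>B\<^esub> d" y] xy carr ab by simp
        ultimately show ?thesis using carr by blast
      qed
    qed
    have "group A" "group B"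
      using one_sided A.one_closed B.one_closed
      by (intro A.group_if_one_sided_inverses B.group_if_one_sided_inverses; blast)+
    then show ?L by (rule regular_schuetzenberger_if_group)
  qed
qed

end
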